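(* Let $n$ be a positive integer and $\mathbf{k}=(k_1,\dots,k_n)$ a vector of positive integers. Then there is a polynomial $\varphi_{n,\mathbf{k}}(s)$ in $s$, of degree $\sum_{i=1}^n k_i$, such that for every positive integer $s$ \[ h_{C_{n,\mathbf{k}}}(s)=\varphi_{n,\mathbf{k}}(s)+(-1)^s\,\frac{1+(-1)^{n+1}}{2^{\,\sum_{i=1}^{n}k_i+2}} . \]
   Context: $C_{n,\mathbf{k}}$ is the circular graph on $n$ vertices $v_1,\dots,v_n$ (arranged in a cycle) in which the vertex $v_i$ carries $k_i$ self-loops. A magic labelling with magic sum $s$ assigns a nonnegative integer to each edge (including loops) so that at each vertex the labels of incident edges (each loop counted once) sum to $s$; $h_{C_{n,\mathbf{k}}}(s)$ denotes the number of such labellings. Explicitly, $h_{C_{n,\mathbf{k}}}(s)$ is the number of nonnegative integer tuples $(\alpha_{i,j}\ (1\le i\le n,\ 1\le j\le k_i);\ \beta_1,\dots,\beta_n)$ with \[ \beta_i+\sum_{j=1}^{k_i}\alpha_{i,j}+\beta_{i+1}=s\qquad(1\le i\le n), \] where $\beta_{n+1}=\beta_1$ (for $n=1$ the condition is $2\beta_1+\sum_j\alpha_{1,j}=s$). *)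

theory Defs
  imports "HOL-Library.FuncSet" "HOL-Computational_Algebra.Polynomial"
begin

definition next_vertex :: "nat \<Rightarrow> nat \<Rightarrow> nat" where
  "next_vertex n i = (if i = n then 1 else i + 1)"

text \<open>
  A labelling of the circular graph on vertices \<open>1, \<dots>, n\<close>, with \<open>k i\<close> loops at vertex \<open>i\<close>, is a
  pair \<open>(\<alpha>, \<beta>)\<close>: \<open>\<alpha> (i, j)\<close> is the label of the \<open>j\<close>-th loop at vertex \<open>i\<close>, and \<open>\<beta> i\<close>,
  \<open>\<beta> (next_vertex n i)\<close> are the labels of the two cycle edges at vertex \<open>i\<close>. For \<open>n = 1\<close> these
  two coincide, so the single cycle edge is counted twice, unlike the loops. Labellings are
  extensional functions, so that each tuple of labels is counted exactly once.
\<close>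

definition magic_labellings ::
    "nat \<Rightarrow> (nat \<Rightarrow> nat) \<Rightarrow> nat \<Rightarrow> ((nat \<times> nat \<Rightarrow> nat) \<times> (nat \<Rightarrow> nat)) set" where
  "magic_labellings n k s =
     {(\<alpha>, \<beta>). \<alpha> \<in> (SIGMA i:{1..n}. {1..k i}) \<rightarrow>\<^sub>E UNIV \<and> \<beta> \<in> {1..n} \<rightarrow>\<^sub>E UNIV \<and>
        (\<forall>i\<in>{1..n}. \<beta> i + (\<Sum>j=1..k i. \<alpha> (i, j)) + \<beta> (next_vertex n i) = s)}"

definition h :: "nat \<Rightarrow> (nat \<Rightarrow> nat) \<Rightarrow> nat \<Rightarrow> nat" where
  "h n k s = card (magic_labellings n k s)"

lemma finite_magic_labellings: "finite (magic_labellings n k s)"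
proof (rule finite_subset)
  let ?L = "SIGMA i:{1..n}. {1..k i}"
  show "magic_labellings n k s \<subseteq> (?L \<rightarrow>\<^sub>E {..s}) \<times> ({1..n} \<rightarrow>\<^sub>E {..s})"
  proof (clarify, intro conjI SigmaI)
    fix \<alpha> \<beta> assume "(\<alpha>, \<beta>) \<in> magic_labellings n k s"
    then have \<alpha>: "\<alpha> \<in> ?L \<rightarrow>\<^sub>E UNIV" and \<beta>: "\<beta> \<in> {1..n} \<rightarrow>\<^sub>E UNIV"
      and eq: "\<And>i. i \<in> {1..n} \<Longrightarrow> \<beta> i + (\<Sum>j=1..k i. \<alpha> (i, j)) + \<beta> (next_vertex n i) = s"
      by (auto simp: magic_labellings_def)
    have "\<alpha> (i, j) \<le> s" if "i \<in> {1..n}" "j \<in> {1..k i}" for i j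
    proof -
      have "\<alpha> (i, j) \<le> (\<Sum>j=1..k i. \<alpha> (i, j))"
        using that(2) by (intro member_le_sum) auto
      then show ?thesis using eq[OF that(1)] by linarith
    qed
    then show "\<alpha> \<in> ?L \<rightarrow>\<^sub>E {..s}"
      using \<alpha> by (auto simp: PiE_iff)
    have "\<beta> i \<le> s" if "i \<in> {1..n}" for i
      using eq[OF that] by linarith
    then show "\<beta> \<in> {1..n} \<rightarrow>\<^sub>E {..s}"
      using \<beta> by (auto simp: PiE_iff)
  qed
  show "finite ((?L \<rightarrow>\<^sub>E {..s}) \<times> ({1..n} \<rightarrow>\<^sub>E {..s}))"
    by (intro finite_cartesian_product finite_PiE finite_SigmaI) auto
qed

end

theory Submission
  imports Defs
begin

text \<open>
  The number of labellings is the trace of a product of kernels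
  \<open>loops (k i) s a b = comps (k i) (s - (a + b))\<close> on \<open>{..s}\<close>. After reflecting every second cycle
  label, \<open>b \<mapsto> s - b\<close>, a vertex with \<open>k\<close> loops acts by \<open>k\<close>-fold prefix or suffix sums. Both preserve
  kernels of the form \<open>[a \<le> x] e (x - a) + R s a x\<close> with \<open>e\<close> and \<open>R\<close> polynomial: a prefix sum
  replaces \<open>e\<close> by its partial sums, a suffix sum by \<open>e\<close> minus its partial sums. For even \<open>n\<close> the trace
  of such a kernel is polynomial in \<open>s\<close>. For odd \<open>n\<close> the last reflection remains and the trace is a
  polynomial plus \<open>T s = e s + e (s - 2) + \<dots>\<close>; the coefficient of \<open>(-1) ^ s\<close> in \<open>T\<close> is halved by each
  of the two operations, hence by each loop. The degree follows from
  \<open>h n k s \<le> (s + 1) ^ K\<close> and \<open>(t + 1) ^ K \<le> h n k ((K + 2) * t)\<close>, where \<open>K = (\<Sum>i=1..n. k i)\<close>.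
\<close>

section \<open>Polynomial functions of one natural variable\<close>

definition polyfun :: "(nat \<Rightarrow> rat) \<Rightarrow> bool" where
  "polyfun f \<longleftrightarrow> (\<exists>p. \<forall>x. f x = poly p (of_nat x))"

lemma polyfun_poly: "polyfun (\<lambda>x. poly p (of_nat x))"
  by (auto simp: polyfun_def)

lemma polyfun_const: "polyfun (\<lambda>_. c)"
  using polyfun_poly[of "[:c:]"] by simp

lemma polyfun_of_nat: "polyfun of_nat"
  using polyfun_poly[of "[:0, 1:]"] by simp

lemma polyfun_add:
  assumes "polyfun f" "polyfun g" shows "polyfun (\<lambda>x. f x + g x)"
proof -
  obtain p q where "\<And>x. f x = poly p (of_nat x)" "\<And>x. g x = poly q (of_nat x)"
    using assms by (auto simp: polyfun_def)
  then show ?thesis using polyfun_poly[of "p + q"] by simp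
qed

lemma polyfun_mult:
  assumes "polyfun f" "polyfun g" shows "polyfun (\<lambda>x. f x * g x)"
proof -
  obtain p q where "\<And>x. f x = poly p (of_nat x)" "\<And>x. g x = poly q (of_nat x)"
    using assms by (auto simp: polyfun_def)
  then show ?thesis using polyfun_poly[of "p * q"] by simp
qed

lemma polyfun_diff:
  assumes "polyfun f" "polyfun g" shows "polyfun (\<lambda>x. f x - g x)"
  using polyfun_add[OF assms(1) polyfun_mult[OF polyfun_const[of "-1"] assms(2)]] by simp

lemma polyfun_sum:
  assumes "\<And>i. i \<in> A \<Longrightarrow> polyfun (f i)" shows "polyfun (\<lambda>x. \<Sum>i\<in>A. f i x)"
  using assms
  by (induction A rule: infinite_finite_induct) (auto intro: polyfun_const polyfun_add)

lemma polyfun_power: "polyfun f \<Longrightarrow> polyfun (\<lambda>x. f x ^ d)"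
  by (induction d) (auto intro: polyfun_const polyfun_mult)

text \<open>Pascal's recursion: summing \<open>(l + 1) ^ (d + 1) - l ^ (d + 1)\<close> over
  \<open>l \<le> x\<close> telescopes to \<open>(x + 1) ^ (d + 1)\<close>, and the binomial theorem
  turns the summand into powers of exponent at most \<open>d\<close>. The power sum of exponent
  \<open>d\<close> enters with coefficient \<open>d + 1\<close>, which is invertible over the
  rationals.\<close>

lemma polyfun_power_sum: "polyfun (\<lambda>x. \<Sum>l\<le>x. of_nat l ^ d)"
proof (induction d rule: less_induct)
  case (less d)
  define S :: "nat \<Rightarrow> nat \<Rightarrow> rat" where "S = (\<lambda>j x. \<Sum>l\<le>x. of_nat l ^ j)"
  have step: "(\<Sum>j\<le>d. of_nat (Suc d choose j) * S j x) = of_nat (Suc x) ^ Suc d" for x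
  proof (induction x)
    case 0
    have "S j 0 = (if j = 0 then 1 else 0)" for j by (auto simp: S_def)
    then show ?case by (simp add: if_distrib[of "(*) _"] sum.delta cong: if_cong)
  next
    case (Suc x)
    have "of_nat (Suc (Suc x)) ^ Suc d = (1 + of_nat (Suc x) :: rat) ^ Suc d"
      by (simp only: of_nat_Suc)
    also have "\<dots> = (\<Sum>j\<le>d. of_nat (Suc d choose j) * of_nat (Suc x) ^ j)
        + of_nat (Suc x) ^ Suc d"
      by (subst add.commute, subst binomial_ring) simp
    finally show ?case using Suc
      by (simp add: S_def distrib_left sum.distrib del: power_Suc of_nat_Suc)
  qed
  have "S d = (\<lambda>x. inverse (of_nat (Suc d)) *
      (of_nat (Suc x) ^ Suc d - (\<Sum>j<d. of_nat (Suc d choose j) * S j x)))"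
  proof
    fix x
    have "of_nat (Suc d) * S d x
        = of_nat (Suc x) ^ Suc d - (\<Sum>j<d. of_nat (Suc d choose j) * S j x)"
      unfolding step[symmetric] by (simp add: lessThan_Suc_atMost[symmetric] del: of_nat_Suc)
    then show "S d x = inverse (of_nat (Suc d)) *
      (of_nat (Suc x) ^ Suc d - (\<Sum>j<d. of_nat (Suc d choose j) * S j x))"
      by (metis (no_types, lifting) left_inverse mult.assoc mult_1 of_nat_neq_0)
  qed
  moreover have "polyfun (\<lambda>x. of_nat (Suc x) :: rat)"
    using polyfun_add[OF polyfun_const[of 1] polyfun_of_nat] by simp
  ultimately have "polyfun (S d)"
    using less
    by (auto simp: S_def simp del: of_nat_Suc power_Suc
        intro!: polyfun_mult[OF polyfun_const] polyfun_diff polyfun_power polyfun_sum)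
  then show ?case by (simp add: S_def)
qed

lemma polyfun_sum_atMost:
  assumes "polyfun f" shows "polyfun (\<lambda>x. \<Sum>l\<le>x. f l)"
proof -
  obtain p where p: "\<And>x. f x = poly p (of_nat x)"
    using assms by (auto simp: polyfun_def)
  have "(\<Sum>l\<le>x. f l) = (\<Sum>i\<le>degree p. coeff p i * (\<Sum>l\<le>x. of_nat l ^ i))" for x
    unfolding p poly_altdef sum_distrib_left by (rule sum.swap)
  then show ?thesis
    by (auto intro!: polyfun_sum polyfun_mult polyfun_const polyfun_power_sum)
qed

section \<open>Polynomial functions of two and three variables\<close>

text \<open>Being generated by products, the class is closed under a linear operation on
  \<open>y\<close> as soon as products are. The class \<open>P\<close> of the first factor is left
  open so that the same closure lemmas serve two variables and, with a pair as first argument,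
  three.\<close>

inductive tensor :: "(('a \<Rightarrow> rat) \<Rightarrow> bool) \<Rightarrow> ('a \<Rightarrow> nat \<Rightarrow> rat) \<Rightarrow> bool" for P where
  prod: "P f \<Longrightarrow> polyfun g \<Longrightarrow> tensor P (\<lambda>x y. f x * g y)"
| add: "tensor P F \<Longrightarrow> tensor P G \<Longrightarrow> tensor P (\<lambda>x y. F x y + G x y)"

lemma tensor_mult_right:
  assumes "tensor P F" "polyfun g" shows "tensor P (\<lambda>x y. F x y * g y)"
  using assms(1)
proof induction
  case (prod f g')
  then show ?case
    using tensor.prod[of P f "\<lambda>y. g' y * g y"] polyfun_mult[OF prod(2) assms(2)]
    by (simp add: mult.assoc)
next
  case (add F G)
  then show ?case using tensor.add[OF add.IH] by (simp add: distrib_right)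
qed

lemma tensor_diff:
  assumes "tensor P F" "tensor P G" shows "tensor P (\<lambda>x y. F x y - G x y)"
  using tensor.add[OF assms(1) tensor_mult_right[OF assms(2) polyfun_const[of "-1"]]] by simp

lemma tensor_sum_atMost:
  assumes "tensor P F" shows "tensor P (\<lambda>x y. \<Sum>l\<le>y. F x l)"
  using assms
proof induction
  case (prod f g)
  then show ?case
    using tensor.prod[of P f "\<lambda>y. \<Sum>l\<le>y. g l"] polyfun_sum_atMost[OF prod(2)]
    by (simp add: sum_distrib_left)
next
  case (add F G)
  then show ?case using tensor.add[OF add.IH] by (simp add: sum.distrib)
qed

abbreviation polyfun2 :: "(nat \<Rightarrow> nat \<Rightarrow> rat) \<Rightarrow> bool" where
  "polyfun2 \<equiv> tensor polyfun"

abbreviation polyfun3 :: "(nat \<times> nat \<Rightarrow> nat \<Rightarrow> rat) \<Rightarrow> bool" where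
  "polyfun3 \<equiv> tensor (\<lambda>f. polyfun2 (curry f))"

lemma polyfun2_fst: "polyfun f \<Longrightarrow> polyfun2 (\<lambda>s a. f s)"
  using tensor.prod[of polyfun f "\<lambda>_. 1"] polyfun_const by simp

lemma polyfun2_snd: "polyfun g \<Longrightarrow> polyfun2 (\<lambda>s a. g a)"
  using tensor.prod[of polyfun "\<lambda>_. 1" g] polyfun_const by simp

lemma polyfun2_mult:
  assumes "polyfun2 F" "polyfun2 G" shows "polyfun2 (\<lambda>s a. F s a * G s a)"
  using assms(2)
proof induction
  case (prod f g)
  have "polyfun2 (\<lambda>s a. F s a * f s)"
    using assms(1)
  proof induction
    case (prod f' g')
    then show ?case
      using tensor.prod[of polyfun "\<lambda>x. f' x * f x" g'] polyfun_mult[OF prod(1) \<open>polyfun f\<close>]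
      by (simp add: ac_simps)
  next
    case (add F G)
    then show ?case using tensor.add[OF add.IH] by (simp add: distrib_right)
  qed
  from tensor_mult_right[OF this prod(2)] show ?case by (simp add: mult.assoc)
next
  case (add F' G')
  then show ?case using tensor.add[OF add.IH] by (simp add: distrib_left)
qed

lemma polyfun2_poly_diff: "polyfun2 (\<lambda>s a. poly p (of_nat s - of_nat a))"
proof (induction p)
  case 0
  then show ?case using polyfun2_fst[OF polyfun_const[of 0]] by simp
next
  case (pCons c p)
  have "polyfun2 (\<lambda>s a. of_nat s - of_nat a)"
    by (intro tensor_diff polyfun2_fst polyfun2_snd polyfun_of_nat)
  from tensor.add[OF polyfun2_fst[OF polyfun_const[of c]] polyfun2_mult[OF this pCons(2)]]
  show ?case by simp
qed

text \<open>Subtraction on \<open>nat\<close> truncates, so a polynomial in \<open>s\<close> and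
  \<open>a\<close> can match only for \<open>a \<le> s\<close>; the witness evaluates the polynomial
  at the rational difference.\<close>

lemma polyfun2_diff:
  assumes "polyfun f"
  obtains F where "polyfun2 F" "\<And>s a. a \<le> s \<Longrightarrow> f (s - a) = F s a"
proof -
  obtain p where "\<And>x. f x = poly p (of_nat x)"
    using assms by (auto simp: polyfun_def)
  then show ?thesis using that[OF polyfun2_poly_diff[of p]] by (simp add: of_nat_diff)
qed

lemma polyfun2_sum:
  assumes "polyfun2 F" shows "polyfun (\<lambda>s. \<Sum>a\<le>s. F s a)"
  using assms
proof induction
  case (prod f g)
  then show ?case
    by (auto simp: sum_distrib_left[symmetric] intro: polyfun_mult polyfun_sum_atMost)
next
  case (add F G)
  then show ?case by (auto simp: sum.distrib intro: polyfun_add)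
qed

lemma polyfun3_of_polyfun2:
  assumes "polyfun2 F" shows "polyfun3 (\<lambda>(s, a) x. F s a)"
proof -
  have "(\<lambda>(s, a) x. F s a) = (\<lambda>z (x :: nat). case_prod F z * 1)"
    by auto
  then show ?thesis
    using assms by (simp only:) (intro tensor.prod polyfun_const, simp)
qed

text \<open>Needed for suffix sums: the total over \<open>{..s}\<close> no longer involves
  \<open>x\<close>.\<close>

lemma polyfun3_total:
  assumes "polyfun3 R" shows "polyfun2 (\<lambda>s a. \<Sum>l\<le>s. R (s, a) l)"
  using assms
proof induction
  case (prod f g)
  then show ?case
    using polyfun2_mult[OF prod(1) polyfun2_fst[OF polyfun_sum_atMost[OF prod(2)]]]
    by (simp add: sum_distrib_left curry_def)
next
  case (add F G)
  then show ?case using tensor.add[OF add.IH] by (simp add: sum.distrib)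
qed

text \<open>This and \<open>polyfun3_antidiagonal\<close> treat the remainder \<open>R\<close> in
  the trace, for even and odd \<open>n\<close> respectively.\<close>

lemma polyfun3_diagonal:
  assumes "polyfun3 R" shows "polyfun (\<lambda>s. \<Sum>a\<le>s. R (s, a) a)"
  using assms
proof induction
  case (prod f g)
  then show ?case
    using polyfun2_sum[OF polyfun2_mult[OF prod(1) polyfun2_snd[OF prod(2)]]]
    by (simp add: curry_def)
next
  case (add F G)
  then show ?case by (auto simp: sum.distrib intro: polyfun_add)
qed

lemma polyfun3_antidiagonal:
  assumes "polyfun3 R" shows "polyfun (\<lambda>s. \<Sum>a\<le>s. R (s, a) (s - a))"
  using assms
proof induction
  case (prod f g)
  obtain G where G: "polyfun2 G" "\<And>s a. a \<le> s \<Longrightarrow> g (s - a) = G s a"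
    by (fact polyfun2_diff[OF prod(2)])
  have "(\<Sum>a\<le>s. f (s, a) * g (s - a)) = (\<Sum>a\<le>s. f (s, a) * G s a)" for s
    using G(2) by simp
  then show ?case
    using polyfun2_sum[OF polyfun2_mult[OF prod(1) G(1)]] by (simp add: curry_def)
next
  case (add F G)
  then show ?case by (auto simp: sum.distrib intro: polyfun_add)
qed

section \<open>Sums in steps of two and their parity coefficient\<close>

text \<open>On generating functions this is division by \<open>1 - z^2\<close>. For polynomial
  \<open>f\<close>, the factor \<open>1 + z\<close> of the denominator is the only source of a term
  in \<open>(-1) ^ s\<close>.\<close>

definition step_sum :: "(nat \<Rightarrow> rat) \<Rightarrow> nat \<Rightarrow> rat" where
  "step_sum f s = (\<Sum>a\<le>s div 2. f (s - 2 * a))"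

definition parity_part :: "rat \<Rightarrow> (nat \<Rightarrow> rat) \<Rightarrow> bool" where
  "parity_part c f \<longleftrightarrow> polyfun (\<lambda>s. step_sum f s - (-1) ^ s * c)"

lemma step_sum_Suc_Suc: "step_sum f (Suc (Suc s)) = f (Suc (Suc s)) + step_sum f s"
  unfolding step_sum_def by (simp add: sum.atMost_Suc_shift del: sum.atMost_Suc)

text \<open>Partial sums divide the generating function by \<open>1 - z\<close>, so this is the
  identity \<open>2 / ((1 - z) (1 - z^2)) = 1 / (1 - z^2) + 1 / (1 - z)^2\<close>.\<close>

lemma step_sum_partial_sums:
  "2 * step_sum (\<lambda>d. \<Sum>l\<le>d. f l) s = step_sum f s + (\<Sum>d\<le>s. \<Sum>l\<le>d. f l)"
proof (induction s rule: induct_nat_012)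
  case (ge2 s)
  then show ?case unfolding step_sum_Suc_Suc by (simp add: distrib_left)
qed (simp_all add: step_sum_def)

text \<open>The double partial sum in \<open>step_sum_partial_sums\<close> is polynomial, so the
  parity term comes from half of \<open>step_sum f\<close> alone.\<close>

lemma parity_part_partial_sums:
  assumes "polyfun f" "parity_part c f"
  shows "parity_part (c / 2) (\<lambda>d. \<Sum>l\<le>d. f l)"
proof -
  have "step_sum (\<lambda>d. \<Sum>l\<le>d. f l) s - (-1) ^ s * (c / 2)
      = (1 / 2) * ((step_sum f s - (-1) ^ s * c) + (\<Sum>d\<le>s. \<Sum>l\<le>d. f l))" for s
    using step_sum_partial_sums[of f s] by (simp add: field_simps)
  then show ?thesis
    using assms unfolding parity_part_def
    by (simp only:) (intro polyfun_mult polyfun_const polyfun_add polyfun_sum_atMost)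
qed

lemma parity_part_diff:
  assumes "parity_part c f" "parity_part d g"
  shows "parity_part (c - d) (\<lambda>x. f x - g x)"
proof -
  have "step_sum (\<lambda>x. f x - g x) s - (-1) ^ s * (c - d)
      = (step_sum f s - (-1) ^ s * c) - (step_sum g s - (-1) ^ s * d)" for s
    by (simp add: step_sum_def sum_subtractf algebra_simps)
  then show ?thesis
    using assms unfolding parity_part_def by (auto intro: polyfun_diff)
qed

text \<open>The step sum is \<open>s div 2 + 1\<close>, that is
  \<open>s / 2 + 3 / 4 + (-1) ^ s / 4\<close>.\<close>

lemma parity_part_one: "parity_part (1 / 4) (\<lambda>_. 1)"
proof -
  have "step_sum (\<lambda>_. 1) s - (-1) ^ s * (1 / 4) = (1 / 2) * of_nat s + 3 / 4" for s
    by (induction s rule: induct_nat_012)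
      (simp_all add: step_sum_Suc_Suc, simp_all add: step_sum_def field_simps)
  then show ?thesis
    unfolding parity_part_def
    by (simp only:) (intro polyfun_add polyfun_mult polyfun_const polyfun_of_nat)
qed

section \<open>Kernels stable under prefix and suffix sums\<close>

text \<open>The index \<open>m\<close> counts the loops passed so far. The exponent is
  \<open>Suc m\<close> because one loop gives \<open>e = 1\<close>, whose parity coefficient is
  \<open>1 / 4\<close>.\<close>

definition good_kernel :: "nat \<Rightarrow> (nat \<Rightarrow> nat \<Rightarrow> nat \<Rightarrow> rat) \<Rightarrow> bool" where
  "good_kernel m W \<longleftrightarrow> (\<exists>e R. polyfun e \<and> parity_part (1 / 2 ^ Suc m) e \<and> polyfun3 R \<and>
     (\<forall>s a x. a \<le> s \<longrightarrow> x \<le> s \<longrightarrow> W s a x = (if a \<le> x then e (x - a) else 0) + R (s, a) x))"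

lemma good_kernel_cong:
  assumes "good_kernel m W" "\<And>s a x. a \<le> s \<Longrightarrow> x \<le> s \<Longrightarrow> W' s a x = W s a x"
  shows "good_kernel m W'"
  using assms unfolding good_kernel_def by (metis (no_types, lifting))

lemma sum_shifted:
  fixes e :: "nat \<Rightarrow> rat"
  shows "(\<Sum>l\<le>x. if a \<le> l then e (l - a) else 0) = (if a \<le> x then \<Sum>d\<le>x - a. e d else 0)"
proof -
  have "(\<Sum>l\<le>x. if a \<le> l then e (l - a) else 0) = (\<Sum>l\<in>{a..x}. e (l - a))"
    by (rule sum.mono_neutral_cong_right) auto
  also have "\<dots> = (if a \<le> x then \<Sum>d\<le>x - a. e d else 0)"
    by (auto intro!: sum.reindex_bij_witness[of _ "\<lambda>d. d + a" "\<lambda>l. l - a"])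
  finally show ?thesis .
qed

lemma good_kernel_prefix:
  assumes "good_kernel m W"
  shows "good_kernel (Suc m) (\<lambda>s a x. \<Sum>l\<le>x. W s a l)"
proof -
  obtain e R where e: "polyfun e" "parity_part (1 / 2 ^ Suc m) e" and R: "polyfun3 R"
    and W: "\<And>s a x. a \<le> s \<Longrightarrow> x \<le> s \<Longrightarrow>
      W s a x = (if a \<le> x then e (x - a) else 0) + R (s, a) x"
    using assms unfolding good_kernel_def by blast
  show ?thesis
    unfolding good_kernel_def
  proof (intro exI conjI allI impI)
    show "polyfun (\<lambda>d. \<Sum>l\<le>d. e l)" by (rule polyfun_sum_atMost[OF e(1)])
    show "parity_part (1 / 2 ^ Suc (Suc m)) (\<lambda>d. \<Sum>l\<le>d. e l)"
      using parity_part_partial_sums[OF e] by (simp add: mult.commute)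
    show "polyfun3 (\<lambda>z x. \<Sum>l\<le>x. R z l)" by (rule tensor_sum_atMost[OF R])
    fix s a x :: nat assume "a \<le> s" "x \<le> s"
    then have "(\<Sum>l\<le>x. W s a l) = (\<Sum>l\<le>x. (if a \<le> l then e (l - a) else 0) + R (s, a) l)"
      by (intro sum.cong) (auto simp: W)
    then show "(\<Sum>l\<le>x. W s a l)
        = (if a \<le> x then \<Sum>l\<le>x - a. e l else 0) + (\<Sum>l\<le>x. R (s, a) l)"
      by (simp add: sum.distrib sum_shifted)
  qed
qed

text \<open>A suffix sum is the total minus the prefix sum plus the last term.\<close>

lemma good_kernel_suffix:
  assumes "good_kernel m W"
  shows "good_kernel (Suc m) (\<lambda>s a x. \<Sum>l=x..s. W s a l)"
proof -
  obtain e R where e: "polyfun e" "parity_part (1 / 2 ^ Suc m) e" and R: "polyfun3 R"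
    and W: "\<And>s a x. a \<le> s \<Longrightarrow> x \<le> s \<Longrightarrow>
      W s a x = (if a \<le> x then e (x - a) else 0) + R (s, a) x"
    using assms unfolding good_kernel_def by blast
  \<comment> \<open>The total of the shifted part of the kernel does not depend on \<open>x\<close>;
    as a polynomial in \<open>s\<close> and \<open>a\<close> it moves into the new
    remainder.\<close>
  obtain F where F: "polyfun2 F" "\<And>s a. a \<le> s \<Longrightarrow> (\<Sum>d\<le>s - a. e d) = F s a"
    by (fact polyfun2_diff[OF polyfun_sum_atMost[OF e(1)]])
  define R' where "R' = (\<lambda>z x. (case z of (s, a) \<Rightarrow> \<lambda>x. F s a + (\<Sum>l\<le>s. R (s, a) l)) x
      - (\<Sum>l\<le>x. R z l) + R z x)"
  show ?thesis
    unfolding good_kernel_def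
  proof (intro exI conjI allI impI)
    show "polyfun (\<lambda>d. e d - (\<Sum>l\<le>d. e l))"
      by (intro polyfun_diff polyfun_sum_atMost e)
    \<comment> \<open>Subtracting the halved coefficient from the whole one leaves a half, just as
      for prefix sums.\<close>
    have "1 / 2 ^ Suc m - 1 / 2 ^ Suc m / 2 = (1 / 2 ^ Suc (Suc m) :: rat)"
      by (simp add: field_simps)
    then show "parity_part (1 / 2 ^ Suc (Suc m)) (\<lambda>d. e d - (\<Sum>l\<le>d. e l))"
      using parity_part_diff[OF e(2) parity_part_partial_sums[OF e]] by metis
    show "polyfun3 R'"
      unfolding R'_def
      by (intro tensor.add tensor_diff tensor_sum_atMost R polyfun3_of_polyfun2 F(1)
          polyfun3_total)
    fix s a x :: nat assume *: "a \<le> s" "x \<le> s"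
    have Wsum: "(\<Sum>l\<le>y. W s a l)
        = (if a \<le> y then \<Sum>l\<le>y - a. e l else 0) + (\<Sum>l\<le>y. R (s, a) l)" if "y \<le> s" for y
    proof -
      have "(\<Sum>l\<le>y. W s a l) = (\<Sum>l\<le>y. (if a \<le> l then e (l - a) else 0) + R (s, a) l)"
        using that * by (intro sum.cong) (auto simp: W)
      then show ?thesis by (simp add: sum.distrib sum_shifted)
    qed
    have "{..s} = {..<x} \<union> {x..s}" using * by auto
    then have "(\<Sum>l\<le>s. W s a l) = (\<Sum>l<x. W s a l) + (\<Sum>l=x..s. W s a l)"
      by (simp add: sum.union_disjoint ivl_disj_int)
    moreover have "(\<Sum>l\<le>x. W s a l) = (\<Sum>l<x. W s a l) + W s a x"
      by (simp add: lessThan_Suc_atMost[symmetric])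
    ultimately have "(\<Sum>l=x..s. W s a l) = (\<Sum>l\<le>s. W s a l) - (\<Sum>l\<le>x. W s a l) + W s a x"
      by simp
    then show "(\<Sum>l=x..s. W s a l)
        = (if a \<le> x then e (x - a) - (\<Sum>l\<le>x - a. e l) else 0) + R' (s, a) x"
      unfolding Wsum[OF le_refl] Wsum[OF *(2)] W[OF *] using * F(2)[of a s]
      by (simp add: R'_def)
  qed
qed

section \<open>Counting the labels of the loops at one vertex\<close>

text \<open>For \<open>k > 0\<close> this is the binomial coefficient
  \<open>(m + k - 1) choose (k - 1)\<close>. The recursion is chosen so that one more loop is one
  more prefix sum.\<close>

primrec comps :: "nat \<Rightarrow> nat \<Rightarrow> nat" where
  "comps 0 m = (if m = 0 then 1 else 0)"
| "comps (Suc k) m = (\<Sum>j\<le>m. comps k j)"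

lemma comps_one: "comps (Suc 0) m = 1"
  by (simp add: sum.delta)

text \<open>Splitting off the last entry \<open>y\<close> leaves a tuple of sum
  \<open>m - y\<close>; reversing the order of summation gives the recursion of
  \<open>comps\<close>. Finiteness is proved alongside because counting the disjoint union over
  \<open>y\<close> needs finite fibres.\<close>

lemma card_comps: "card {f \<in> {1..k} \<rightarrow>\<^sub>E UNIV. (\<Sum>j=1..k. f j) = m} = comps k m"
  and finite_comps: "finite {f \<in> {1..k} \<rightarrow>\<^sub>E (UNIV :: nat set). (\<Sum>j=1..k. f j) = m}"
proof (induction k arbitrary: m)
  case 0
  {
    case 1
    then show ?case by (auto simp: PiE_empty_domain)
  next
    case 2
    then show ?case by (auto simp: PiE_empty_domain)
  }
next
  case (Suc k)
  define S :: "nat \<Rightarrow> nat \<Rightarrow> (nat \<Rightarrow> nat) set"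
    where "S = (\<lambda>k m. {f \<in> {1..k} \<rightarrow>\<^sub>E UNIV. (\<Sum>j=1..k. f j) = m})"
  have fin: "finite (S k m)" and card: "card (S k m) = comps k m" for m
    using Suc.IH by (simp_all add: S_def)
  let ?u = "\<lambda>(y, g). g(Suc k := y)"
  have ivl: "{1..Suc k} = insert (Suc k) {1..k}" by auto
  have upd: "(\<Sum>j=1..k. (g(Suc k := y)) j) = (\<Sum>j=1..k. g j)" for g :: "nat \<Rightarrow> nat" and y
    by (intro sum.cong) auto
  have img: "S (Suc k) m = ?u ` (SIGMA y:{..m}. S k (m - y))" for m
  proof (intro equalityI subsetI)
    fix f assume "f \<in> S (Suc k) m"
    then have "f \<in> insert (Suc k) {1..k} \<rightarrow>\<^sub>E UNIV" and eq: "(\<Sum>j=1..Suc k. f j) = m"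
      unfolding S_def ivl by simp_all
    then have "f \<in> ?u ` (UNIV \<times> ({1..k} \<rightarrow>\<^sub>E UNIV))"
      unfolding PiE_insert_eq by simp
    then obtain y g where "f = g(Suc k := y)" "g \<in> {1..k} \<rightarrow>\<^sub>E UNIV" by auto
    with eq show "f \<in> ?u ` (SIGMA y:{..m}. S k (m - y))"
      by (intro image_eqI[of _ _ "(y, g)"]) (auto simp: S_def upd simp del: fun_upd_apply, auto)
  next
    fix f assume "f \<in> ?u ` (SIGMA y:{..m}. S k (m - y))"
    then obtain y g where f: "f = g(Suc k := y)" and "y \<le> m" "g \<in> S k (m - y)" by auto
    then have g: "g \<in> {1..k} \<rightarrow>\<^sub>E UNIV" and "(\<Sum>j=1..Suc k. f j) = m"
      by (auto simp: S_def f upd simp del: fun_upd_apply) simp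
    moreover have "f \<in> insert (Suc k) {1..k} \<rightarrow>\<^sub>E UNIV"
      unfolding PiE_insert_eq f using g by auto
    ultimately show "f \<in> S (Suc k) m"
      unfolding S_def ivl by simp
  qed
  have "inj_on ?u (UNIV \<times> ({1..k} \<rightarrow>\<^sub>E UNIV))"
    by (rule inj_combinator) auto
  then have inj: "inj_on ?u (SIGMA y:{..m}. S k (m - y))" for m
    by (rule inj_on_subset) (auto simp: S_def)
  have "card (S (Suc k) m) = comps (Suc k) m" for m
  proof -
    have "card (S (Suc k) m) = (\<Sum>y\<le>m. comps k (m - y))"
      unfolding img by (simp add: card_image[OF inj] card_SigmaI fin card)
    also have "\<dots> = comps (Suc k) m"
      by (auto intro!: sum.reindex_bij_witness[of _ "\<lambda>j. m - j" "\<lambda>j. m - j"])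
    finally show ?thesis .
  qed
  moreover have "finite (S (Suc k) m)" for m
    unfolding img by (intro finite_imageI finite_SigmaI fin) auto
  ultimately show "card {f \<in> {1..Suc k} \<rightarrow>\<^sub>E UNIV. (\<Sum>j=1..Suc k. f j) = m} = comps (Suc k) m"
    and "finite {f \<in> {1..Suc k} \<rightarrow>\<^sub>E (UNIV :: nat set). (\<Sum>j=1..Suc k. f j) = m}" for m
    by (simp_all add: S_def)
qed

lemma comps_upper: "comps (Suc k) m \<le> (m + 1) ^ k"
proof (induction k arbitrary: m)
  case 0
  then show ?case by (simp add: comps_one del: comps.simps)
next
  case (Suc k)
  have "comps (Suc (Suc k)) m \<le> (\<Sum>j\<le>m. (m + 1) ^ k)"
    unfolding comps.simps(2)[of "Suc k"]
    by (intro sum_mono order_trans[OF Suc] power_mono) auto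
  then show ?case by simp
qed

lemma comps_lower: "t * k \<le> m \<Longrightarrow> (t + 1) ^ k \<le> comps (Suc k) m"
proof (induction k arbitrary: m)
  case 0
  then show ?case by (simp add: comps_one del: comps.simps)
next
  case (Suc k)
  \<comment> \<open>Only the last \<open>t + 1\<close> terms of the recursion are kept:
    \<open>m \<ge> t * Suc k\<close> makes each such \<open>j\<close> at least
    \<open>t * k\<close>.\<close>
  have "(t + 1) ^ Suc k = (\<Sum>j\<in>{m - t..m}. (t + 1) ^ k)"
    using Suc.prems by simp
  also have "\<dots> \<le> (\<Sum>j\<in>{m - t..m}. comps (Suc k) j)"
    using Suc.prems by (intro sum_mono Suc.IH) auto
  also have "\<dots> \<le> comps (Suc (Suc k)) m"
    unfolding comps.simps(2)[of "Suc k"] by (intro sum_mono2) auto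
  finally show ?case .
qed

text \<open>The index is \<open>Suc k\<close> because \<open>comps 0\<close> is the sequence 1, 0,
  0, ..., which is not polynomial.\<close>

lemma polyfun_comps: "polyfun (\<lambda>m. of_nat (comps (Suc k) m))"
proof (induction k)
  case 0
  then show ?case by (simp add: comps_one polyfun_const del: comps.simps)
next
  case (Suc k)
  then show ?case
    unfolding comps.simps(2)[of "Suc k"] of_nat_sum by (rule polyfun_sum_atMost)
qed

lemma parity_part_comps: "parity_part (1 / 2 ^ Suc (Suc k)) (\<lambda>m. of_nat (comps (Suc k) m))"
proof (induction k)
  case 0
  then show ?case using parity_part_one by (simp add: comps_one del: comps.simps)
next
  case (Suc k)
  from parity_part_partial_sums[OF polyfun_comps Suc]
  show ?case
    unfolding comps.simps(2)[of "Suc k"] of_nat_sum by (simp add: mult.commute)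
qed

section \<open>Iterated prefix and suffix sums of kernels\<close>

text \<open>Convolution with \<open>comps k\<close> is the \<open>k\<close>-fold prefix sum, so
  \<open>good_kernel_prefix\<close> applies \<open>k\<close> times.\<close>

lemma good_kernel_prefix_comps:
  assumes "good_kernel m W"
  shows "good_kernel (m + k) (\<lambda>s a x. \<Sum>l\<le>x. W s a l * of_nat (comps k (x - l)))"
proof (induction k)
  case 0
  have "(\<Sum>l\<le>x. W s a l * of_nat (comps 0 (x - l))) = W s a x" for s a x
  proof -
    have "(\<Sum>l\<le>x. W s a l * of_nat (comps 0 (x - l)))
        = (\<Sum>l\<le>x. if l = x then W s a l else 0)"
      by (intro sum.cong) auto
    then show ?thesis by simp
  qed
  then show ?case using assms by simp
next
  case (Suc k)
  have "(\<Sum>l\<le>x. W s a l * of_nat (comps (Suc k) (x - l)))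
      = (\<Sum>y\<le>x. \<Sum>l\<le>y. W s a l * of_nat (comps k (y - l)))" for s a x
  proof -
    have "(\<Sum>l\<le>x. W s a l * of_nat (comps (Suc k) (x - l)))
        = (\<Sum>l\<le>x. \<Sum>y=l..x. W s a l * of_nat (comps k (y - l)))"
    proof (intro sum.cong refl)
      fix l assume l: "l \<in> {..x}"
      have "comps (Suc k) (x - l) = (\<Sum>y=l..x. comps k (y - l))"
        using l by (auto intro!: sum.reindex_bij_witness[of _ "\<lambda>y. y - l" "\<lambda>j. j + l"])
      then show "W s a l * of_nat (comps (Suc k) (x - l))
          = (\<Sum>y=l..x. W s a l * of_nat (comps k (y - l)))"
        by (simp only: of_nat_sum sum_distrib_left)
    qed
    \<comment> \<open>Both sides sum over the triangle \<open>l \<le> y \<le> x\<close>.\<close>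
    also have "\<dots> = (\<Sum>y\<le>x. \<Sum>l\<le>y. W s a l * of_nat (comps k (y - l)))"
      unfolding sum.Sigma[OF finite_atMost ballI[OF finite_atLeastAtMost]]
        sum.Sigma[OF finite_atMost ballI[OF finite_atMost]]
      by (rule sum.reindex_bij_witness[of _ "\<lambda>(y, l). (l, y)" "\<lambda>(l, y). (y, l)"]) auto
    finally show ?thesis .
  qed
  then show ?case using good_kernel_prefix[OF Suc] by simp
qed

lemma good_kernel_suffix_comps:
  assumes "good_kernel m W"
  shows "good_kernel (m + k) (\<lambda>s a x. \<Sum>l=x..s. W s a l * of_nat (comps k (l - x)))"
proof (induction k)
  case 0
  \<comment> \<open>For \<open>x > s\<close> the sum is empty while \<open>W s a x\<close> is
    arbitrary, so the two kernels are identified only on \<open>{..s}\<close> by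
    \<open>good_kernel_cong\<close>.\<close>
  have "(\<Sum>l=x..s. W s a l * of_nat (comps 0 (l - x))) = W s a x" if "x \<le> s" for s a x
  proof -
    have "(\<Sum>l=x..s. W s a l * of_nat (comps 0 (l - x)))
        = (\<Sum>l=x..s. if l = x then W s a l else 0)"
      by (intro sum.cong) auto
    then show ?thesis using that by simp
  qed
  then show ?case using good_kernel_cong[OF assms] by simp
next
  case (Suc k)
  have "(\<Sum>l=x..s. W s a l * of_nat (comps (Suc k) (l - x)))
      = (\<Sum>y=x..s. \<Sum>l=y..s. W s a l * of_nat (comps k (l - y)))" for s a x
  proof -
    have "(\<Sum>l=x..s. W s a l * of_nat (comps (Suc k) (l - x)))
        = (\<Sum>l=x..s. \<Sum>y=x..l. W s a l * of_nat (comps k (l - y)))"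
    proof (intro sum.cong refl)
      fix l assume l: "l \<in> {x..s}"
      have "comps (Suc k) (l - x) = (\<Sum>y=x..l. comps k (l - y))"
        using l by (auto intro!: sum.reindex_bij_witness[of _ "\<lambda>y. l - y" "\<lambda>j. l - j"])
      then show "W s a l * of_nat (comps (Suc k) (l - x))
          = (\<Sum>y=x..l. W s a l * of_nat (comps k (l - y)))"
        by (simp only: of_nat_sum sum_distrib_left)
    qed
    also have "\<dots> = (\<Sum>y=x..s. \<Sum>l=y..s. W s a l * of_nat (comps k (l - y)))"
      unfolding sum.Sigma[OF finite_atLeastAtMost ballI[OF finite_atLeastAtMost]]
      by (rule sum.reindex_bij_witness[of _ "\<lambda>(y, l). (l, y)" "\<lambda>(l, y). (y, l)"]) auto
    finally show ?thesis .
  qed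
  then show ?case using good_kernel_suffix[OF Suc] by simp
qed

section \<open>Transfer matrices and the trace formula\<close>

text \<open>An entry of the transfer matrix of one vertex, indexed by its two cycle labels. Without
  the test, truncated subtraction would yield \<open>comps k 0 = 1\<close> where no labelling
  exists.\<close>

definition loops :: "nat \<Rightarrow> nat \<Rightarrow> nat \<Rightarrow> nat \<Rightarrow> nat" where
  "loops k s a b = (if a + b \<le> s then comps k (s - (a + b)) else 0)"

text \<open>This is the entry at \<open>(a, b)\<close> of the matrix product
  \<open>M 1 * ... * M n\<close> over the index set \<open>A\<close>.\<close>

primrec walk :: "(nat \<Rightarrow> nat \<Rightarrow> nat \<Rightarrow> 'a::comm_semiring_1) \<Rightarrow> nat set \<Rightarrow> nat \<Rightarrow> nat \<Rightarrow> nat \<Rightarrow> 'a"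
  where
  "walk M A 0 a b = (if a = b then 1 else 0)"
| "walk M A (Suc n) a b = (\<Sum>l\<in>A. walk M A n a l * M (Suc n) l b)"

lemma sum_PiE_insert:
  assumes "x \<notin> I"
  shows "(\<Sum>f\<in>insert x I \<rightarrow>\<^sub>E A. g f) = (\<Sum>y\<in>A. \<Sum>f\<in>I \<rightarrow>\<^sub>E A. g (f(x := y)))"
proof -
  have "(\<Sum>f\<in>insert x I \<rightarrow>\<^sub>E A. g f) = (\<Sum>z\<in>A \<times> (I \<rightarrow>\<^sub>E A). g (case z of (y, f) \<Rightarrow> f(x := y)))"
    unfolding PiE_insert_eq using inj_combinator[OF assms, of "\<lambda>_. A"]
    by (subst sum.reindex) (simp_all add: o_def)
  then show ?thesis by (simp add: sum.cartesian_product case_prod_beta)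
qed

text \<open>The weight \<open>G\<close> couples the two ends of a path and later closes the cycle.
  It is arbitrary because the induction step absorbs the last matrix into it.\<close>

lemma sum_walk:
  fixes M :: "nat \<Rightarrow> nat \<Rightarrow> nat \<Rightarrow> 'a::comm_semiring_1"
  assumes "finite A"
  shows "(\<Sum>\<beta>\<in>{1..Suc n} \<rightarrow>\<^sub>E A. (\<Prod>i=1..n. M i (\<beta> i) (\<beta> (Suc i))) * G (\<beta> 1) (\<beta> (Suc n)))
    = (\<Sum>a\<in>A. \<Sum>b\<in>A. walk M A n a b * G a b)"
proof (induction n arbitrary: G)
  case 0
  have "{1..Suc 0} = insert 1 {}" by auto
  then have "(\<Sum>\<beta>\<in>{1..Suc 0} \<rightarrow>\<^sub>E A. G (\<beta> 1) (\<beta> (Suc 0))) = (\<Sum>a\<in>A. G a a)"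
    by (simp add: sum_PiE_insert PiE_empty_domain)
  also have "\<dots> = (\<Sum>a\<in>A. \<Sum>b\<in>A. if a = b then G a b else 0)"
    using assms by simp
  also have "\<dots> = (\<Sum>a\<in>A. \<Sum>b\<in>A. (if a = b then 1 else 0) * G a b)"
    by (intro sum.cong) auto
  finally show ?case by simp
next
  case (Suc n)
  have "{1..Suc (Suc n)} = insert (Suc (Suc n)) {1..Suc n}" by auto
  then have "(\<Sum>\<beta>\<in>{1..Suc (Suc n)} \<rightarrow>\<^sub>E A.
        (\<Prod>i=1..Suc n. M i (\<beta> i) (\<beta> (Suc i))) * G (\<beta> 1) (\<beta> (Suc (Suc n))))
      = (\<Sum>y\<in>A. \<Sum>\<beta>\<in>{1..Suc n} \<rightarrow>\<^sub>E A. (\<Prod>i=1..n. M i (\<beta> i) (\<beta> (Suc i))) *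
          (M (Suc n) (\<beta> (Suc n)) y * G (\<beta> 1) y))"
    by (simp only: sum_PiE_insert) (simp add: sum_PiE_insert mult.assoc)
  also have "\<dots> = (\<Sum>y\<in>A. \<Sum>a\<in>A. \<Sum>b\<in>A. walk M A n a b * (M (Suc n) b y * G a y))"
    using Suc.IH[of "\<lambda>a b. M (Suc n) b y * G a y" for y] by simp
  also have "\<dots> = (\<Sum>a\<in>A. \<Sum>y\<in>A. \<Sum>b\<in>A. walk M A n a b * (M (Suc n) b y * G a y))"
    by (rule sum.swap)
  also have "\<dots> = (\<Sum>a\<in>A. \<Sum>y\<in>A. walk M A (Suc n) a y * G a y)"
    by (simp add: sum_distrib_right mult.assoc)
  finally show ?case .
qed

text \<open>Currying turns a function on a dependent sum into a family of functions, and the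
  conditions at distinct \<open>i\<close> are independent. Restriction at both levels makes currying
  a bijection of extensional functions.\<close>

lemma card_PiE_Sigma:
  assumes "finite I" "\<And>i. i \<in> I \<Longrightarrow> T i \<subseteq> J i \<rightarrow>\<^sub>E UNIV"
  shows "card {f \<in> Sigma I J \<rightarrow>\<^sub>E UNIV. \<forall>i\<in>I. (\<lambda>j\<in>J i. f (i, j)) \<in> T i} = (\<Prod>i\<in>I. card (T i))"
proof -
  have "bij_betw (\<lambda>f. \<lambda>i\<in>I. \<lambda>j\<in>J i. f (i, j))
      {f \<in> Sigma I J \<rightarrow>\<^sub>E UNIV. \<forall>i\<in>I. (\<lambda>j\<in>J i. f (i, j)) \<in> T i} (Pi\<^sub>E I T)"
  proof (rule bij_betw_byWitness[where f' = "\<lambda>g. \<lambda>(i, j)\<in>Sigma I J. g i j"])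
    have *: "(\<lambda>j\<in>J i. (\<lambda>(i, j)\<in>Sigma I J. g i j) (i, j)) = g i"
      if "g \<in> Pi\<^sub>E I T" "i \<in> I" for g i
    proof -
      have "g i \<in> J i \<rightarrow>\<^sub>E UNIV" using that assms(2) by auto
      then show ?thesis using that(2) by (auto simp: fun_eq_iff restrict_def PiE_iff extensional_def)
    qed
    show "\<forall>g\<in>Pi\<^sub>E I T. (\<lambda>i\<in>I. \<lambda>j\<in>J i. (\<lambda>(i, j)\<in>Sigma I J. g i j) (i, j)) = g"
    proof
      fix g assume g: "g \<in> Pi\<^sub>E I T"
      show "(\<lambda>i\<in>I. \<lambda>j\<in>J i. (\<lambda>(i, j)\<in>Sigma I J. g i j) (i, j)) = g"
      proof
        fix i
        show "(\<lambda>i\<in>I. \<lambda>j\<in>J i. (\<lambda>(i, j)\<in>Sigma I J. g i j) (i, j)) i = g i"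
          \<comment> \<open>Outside \<open>I\<close> both sides are
            \<open>undefined\<close>.\<close>
          using *[OF g, of i] PiE_arb[OF g, of i] by (cases "i \<in> I") simp_all
      qed
    qed
    show "(\<lambda>g. \<lambda>(i, j)\<in>Sigma I J. g i j) ` Pi\<^sub>E I T
        \<subseteq> {f \<in> Sigma I J \<rightarrow>\<^sub>E UNIV. \<forall>i\<in>I. (\<lambda>j\<in>J i. f (i, j)) \<in> T i}"
    proof safe
      fix g i assume g: "g \<in> Pi\<^sub>E I T" and i: "i \<in> I"
      show "(\<lambda>j\<in>J i. (\<lambda>(i, j)\<in>Sigma I J. g i j) (i, j)) \<in> T i"
        unfolding *[OF g i] using g i by auto
    qed (auto split: if_splits)
    show "\<forall>f\<in>{f \<in> Sigma I J \<rightarrow>\<^sub>E UNIV. \<forall>i\<in>I. (\<lambda>j\<in>J i. f (i, j)) \<in> T i}.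
        (\<lambda>(i, j)\<in>Sigma I J. (\<lambda>i\<in>I. \<lambda>j\<in>J i. f (i, j)) i j) = f"
      by (auto simp: fun_eq_iff PiE_iff extensional_def restrict_def)
  qed auto
  then show ?thesis
    using assms(1) by (simp add: bij_betw_same_card card_PiE)
qed

text \<open>Once the cycle labels are fixed, the loops at different vertices are labelled
  independently.\<close>

lemma h_eq_sum_loops:
  "h n k s = (\<Sum>\<beta>\<in>{1..n} \<rightarrow>\<^sub>E {..s}. \<Prod>i=1..n. loops (k i) s (\<beta> i) (\<beta> (next_vertex n i)))"
proof -
  define L where "L = (\<lambda>\<beta>. {\<alpha> \<in> (SIGMA i:{1..n}. {1..k i}) \<rightarrow>\<^sub>E UNIV.
    \<forall>i\<in>{1..n}. \<beta> i + (\<Sum>j=1..k i. \<alpha> (i, j)) + \<beta> (next_vertex n i) = s})"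
  \<comment> \<open>The pair is swapped so that the loop labels form a fibre over the cycle labels,
    each of which is at most \<open>s\<close> by its vertex equation.\<close>
  have magic: "magic_labellings n k s = prod.swap ` Sigma ({1..n} \<rightarrow>\<^sub>E {..s}) L"
  proof (intro equalityI subsetI)
    fix z assume z: "z \<in> magic_labellings n k s"
    obtain \<alpha> \<beta> where z_eq: "z = (\<alpha>, \<beta>)" by (cases z)
    have eq: "\<forall>i\<in>{1..n}. \<beta> i + (\<Sum>j=1..k i. \<alpha> (i, j)) + \<beta> (next_vertex n i) = s"
      using z by (simp add: magic_labellings_def z_eq)
    have "\<beta> i \<le> s" if "i \<in> {1..n}" for i
      using eq[rule_format, OF that] by linarith
    with z show "z \<in> prod.swap ` Sigma ({1..n} \<rightarrow>\<^sub>E {..s}) L"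
      by (intro image_eqI[of _ _ "(\<beta>, \<alpha>)"]) (auto simp: magic_labellings_def L_def z_eq PiE_iff)
  qed (auto simp: magic_labellings_def L_def PiE_iff)
  have fin: "finite (L \<beta>)" if "\<beta> \<in> {1..n} \<rightarrow>\<^sub>E {..s}" for \<beta>
  proof (rule finite_subset)
    show "L \<beta> \<subseteq> fst ` magic_labellings n k s"
    proof
      fix \<alpha> assume "\<alpha> \<in> L \<beta>"
      then have "(\<alpha>, \<beta>) \<in> prod.swap ` Sigma ({1..n} \<rightarrow>\<^sub>E {..s}) L"
        using that by (intro image_eqI[of _ _ "(\<beta>, \<alpha>)"] SigmaI) simp_all
      then show "\<alpha> \<in> fst ` magic_labellings n k s"
        unfolding magic[symmetric] by (rule image_eqI[rotated]) simp
    qed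
  qed (intro finite_imageI finite_magic_labellings)
  have card: "card (L \<beta>) = (\<Prod>i=1..n. loops (k i) s (\<beta> i) (\<beta> (next_vertex n i)))" for \<beta>
  proof -
    define T where "T = (\<lambda>i. {f \<in> {1..k i} \<rightarrow>\<^sub>E UNIV.
      \<beta> i + (\<Sum>j=1..k i. f j) + \<beta> (next_vertex n i) = s})"
    have "L \<beta> = {\<alpha> \<in> (SIGMA i:{1..n}. {1..k i}) \<rightarrow>\<^sub>E UNIV.
        \<forall>i\<in>{1..n}. (\<lambda>j\<in>{1..k i}. \<alpha> (i, j)) \<in> T i}"
      by (auto simp: L_def T_def)
    also have "card \<dots> = (\<Prod>i=1..n. card (T i))"
      by (rule card_PiE_Sigma) (auto simp: T_def)
    finally have L: "card (L \<beta>) = (\<Prod>i=1..n. card (T i))" .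
    have "card (T i) = loops (k i) s (\<beta> i) (\<beta> (next_vertex n i))" for i
    proof (cases "\<beta> i + \<beta> (next_vertex n i) \<le> s")
      case True
      then have "T i = {f \<in> {1..k i} \<rightarrow>\<^sub>E UNIV.
          (\<Sum>j=1..k i. f j) = s - (\<beta> i + \<beta> (next_vertex n i))}"
        by (auto simp: T_def)
      then show ?thesis using True by (simp only: card_comps loops_def if_True)
    next
      case False
      then have "T i = {}" by (auto simp: T_def)
      then show ?thesis using False by (simp add: loops_def)
    qed
    with L show ?thesis by simp
  qed
  have "h n k s = card (Sigma ({1..n} \<rightarrow>\<^sub>E {..s}) L)"
    unfolding h_def magic by (rule card_image) (auto simp: inj_on_def)
  also have "\<dots> = (\<Sum>\<beta>\<in>{1..n} \<rightarrow>\<^sub>E {..s}. card (L \<beta>))"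
    by (rule card_SigmaI) (intro finite_PiE ballI fin; simp)+
  finally show ?thesis by (simp only: card)
qed

lemma h_eq_trace:
  assumes "n \<ge> 1"
  shows "rat_of_nat (h n k s) = (\<Sum>a\<le>s. walk (\<lambda>i a b. of_nat (loops (k i) s a b)) {..s} n a a)"
proof -
  obtain m where n: "n = Suc m" using assms by (cases n) auto
  let ?M = "\<lambda>i a b. rat_of_nat (loops (k i) s a b)"
  \<comment> \<open>The last vertex is set apart since its successor is vertex 1. For
    \<open>m = 0\<close> the remaining factor has \<open>\<beta> 1\<close> in both arguments: the
    single edge counted twice.\<close>
  have split: "(\<Prod>i=1..n. ?M i (\<beta> i) (\<beta> (next_vertex n i)))
      = (\<Prod>i=1..m. ?M i (\<beta> i) (\<beta> (Suc i))) * ?M n (\<beta> (Suc m)) (\<beta> 1)" for \<beta>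
    by (simp add: n next_vertex_def)
  have "rat_of_nat (h n k s) = (\<Sum>\<beta>\<in>{1..Suc m} \<rightarrow>\<^sub>E {..s}.
      (\<Prod>i=1..m. ?M i (\<beta> i) (\<beta> (Suc i))) * ?M n (\<beta> (Suc m)) (\<beta> 1))"
    unfolding h_eq_sum_loops of_nat_sum of_nat_prod split by (simp only: n)
  also have "\<dots> = (\<Sum>a\<le>s. \<Sum>b\<le>s. walk ?M {..s} m a b * ?M n b a)"
    by (rule sum_walk) simp
  also have "\<dots> = (\<Sum>a\<le>s. walk ?M {..s} n a a)"
    by (simp add: n)
  finally show ?thesis .
qed

section \<open>Polynomiality up to the parity term\<close>

text \<open>Reflecting the endpoint after an odd number of vertices makes each transfer matrix
  triangular, alternately lower and upper, and hence an iterated prefix or suffix sum. The induction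
  starts at one vertex, since the identity kernel is not good.\<close>

lemma good_kernel_walk:
  assumes "m \<ge> 1" "\<forall>i\<in>{1..m}. k i \<ge> 1"
  shows "good_kernel (\<Sum>i=1..m. k i)
    (\<lambda>s a x. walk (\<lambda>i a b. of_nat (loops (k i) s a b)) {..s} m a (if even m then x else s - x))"
  using assms
proof (induction m rule: nat_induct_at_least)
  case base
  then obtain k' where k': "k 1 = Suc k'" by (cases "k 1") auto
  have "walk (\<lambda>i a b. of_nat (loops (k i) s a b)) {..s} 1 a (s - x)
      = (if a \<le> x then of_nat (comps (Suc k') (x - a)) else 0) + (0 :: rat)"
    if "a \<le> s" "x \<le> s" for s a x
  proof -
    have "walk (\<lambda>i a b. rat_of_nat (loops (k i) s a b)) {..s} 1 a (s - x)
        = (\<Sum>l\<le>s. if l = a then of_nat (loops (k 1) s l (s - x)) else 0)"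
      unfolding One_nat_def walk.simps by (intro sum.cong) auto
    also have "\<dots> = of_nat (loops (k 1) s a (s - x))"
      using that by simp
    finally show ?thesis
      using that by (simp only:) (auto simp: loops_def k' simp del: comps.simps One_nat_def)
  qed
  moreover have "polyfun3 (\<lambda>(s, a) x. 0)"
    by (rule polyfun3_of_polyfun2[OF polyfun2_fst[OF polyfun_const]])
  then have "polyfun3 (\<lambda>_ _. 0)" by (simp add: case_prod_beta')
  ultimately show ?case
    unfolding good_kernel_def using polyfun_comps parity_part_comps k'
    by (intro exI[of _ "\<lambda>m. of_nat (comps (Suc k') m)"] exI[of _ "\<lambda>_ _. 0"])
      (auto simp del: comps.simps walk.simps)
next
  case (Suc m)
  let ?w = "\<lambda>s. walk (\<lambda>i a b. of_nat (loops (k i) s a b)) {..s} :: nat \<Rightarrow> nat \<Rightarrow> nat \<Rightarrow> rat"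
  let ?c = "\<lambda>d. of_nat (comps (k (Suc m)) d) :: rat"
  have IH: "good_kernel (\<Sum>i=1..m. k i) (\<lambda>s a x. ?w s m a (if even m then x else s - x))"
    using Suc by simp
  show ?case
  proof (cases "even m")
    case True
    \<comment> \<open>The constraint \<open>l + (s - x) \<le> s\<close> says
      \<open>l \<le> x\<close>, and the loops then make up \<open>x - l\<close>.\<close>
    have "?w s (Suc m) a (s - x) = (\<Sum>l\<le>x. ?w s m a l * ?c (x - l))" if "x \<le> s" for s a x
      unfolding walk.simps using that
      by (intro sum.mono_neutral_cong_right) (auto simp: loops_def)
    then show ?thesis
      using True good_kernel_cong[OF good_kernel_prefix_comps[OF IH, of "k (Suc m)"]]
      by (simp del: walk.simps)
  next
    case False
    have "?w s (Suc m) a x = (\<Sum>l=x..s. ?w s m a (s - l) * ?c (l - x))" if "x \<le> s" for s a x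
    proof -
      \<comment> \<open>The summation label is reflected, as the induction hypothesis describes the
        kernel at \<open>s - l\<close>. The constraint becomes \<open>x \<le> l\<close>.\<close>
      have "?w s (Suc m) a x = (\<Sum>l\<le>s. ?w s m a (s - l) * of_nat (loops (k (Suc m)) s (s - l) x))"
        unfolding walk.simps
        by (rule sum.reindex_bij_witness[of _ "\<lambda>l. s - l" "\<lambda>l. s - l"]) auto
      also have "\<dots> = (\<Sum>l=x..s. ?w s m a (s - l) * ?c (l - x))"
        using that by (intro sum.mono_neutral_cong_right) (auto simp: loops_def)
      finally show ?thesis .
    qed
    then show ?thesis
      using False good_kernel_cong[OF good_kernel_suffix_comps[OF IH, of "k (Suc m)"]]
      by (simp del: walk.simps)
  qed
qed

lemma polyfun_h:
  assumes "n \<ge> 1" "\<forall>i\<in>{1..n}. k i \<ge> 1"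
  shows "polyfun (\<lambda>s. of_nat (h n k s)
    - (-1) ^ s * (1 + (-1) ^ (n + 1)) / 2 ^ ((\<Sum>i=1..n. k i) + 2))"
proof -
  let ?K = "\<Sum>i=1..n. k i"
  let ?w = "\<lambda>s. walk (\<lambda>i a b. of_nat (loops (k i) s a b)) {..s} :: nat \<Rightarrow> nat \<Rightarrow> nat \<Rightarrow> rat"
  obtain e R where e: "polyfun e" "parity_part (1 / 2 ^ Suc ?K) e" and R: "polyfun3 R"
    and W: "\<And>s a x. a \<le> s \<Longrightarrow> x \<le> s \<Longrightarrow> ?w s n a (if even n then x else s - x)
      = (if a \<le> x then e (x - a) else 0) + R (s, a) x"
    using good_kernel_walk[OF assms] unfolding good_kernel_def by blast
  show ?thesis
  proof (cases "even n")
    case True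
    \<comment> \<open>For even \<open>n\<close> the trace takes \<open>x = a\<close>, where the
      first part of the kernel contributes the constant \<open>e 0\<close>.\<close>
    have "of_nat (h n k s) = (\<Sum>a\<le>s. e 0) + (\<Sum>a\<le>s. R (s, a) a)" for s
    proof -
      have "of_nat (h n k s) = (\<Sum>a\<le>s. e 0 + R (s, a) a)"
        unfolding h_eq_trace[OF assms(1)] using W True by (intro sum.cong) auto
      then show ?thesis by (simp only: sum.distrib)
    qed
    then show ?thesis
      using True polyfun_add[OF polyfun_sum_atMost[OF polyfun_const[of "e 0"]] polyfun3_diagonal[OF R]]
      by simp
  next
    case False
    \<comment> \<open>For odd \<open>n\<close> the endpoint \<open>a\<close> is
      \<open>x = s - a\<close>, so \<open>e\<close> is evaluated at \<open>s - 2 * a\<close> for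
      \<open>2 * a \<le> s\<close>.\<close>
    have "of_nat (h n k s) = step_sum e s + (\<Sum>a\<le>s. R (s, a) (s - a))" for s
    proof -
      have "of_nat (h n k s) = (\<Sum>a\<le>s. (if a \<le> s - a then e (s - a - a) else 0) + R (s, a) (s - a))"
        unfolding h_eq_trace[OF assms(1)]
      proof (intro sum.cong refl)
        fix a assume "a \<in> {..s}"
        then show "?w s n a a = (if a \<le> s - a then e (s - a - a) else 0) + R (s, a) (s - a)"
          using W[of a s "s - a"] False by simp
      qed
      also have "\<dots> = (\<Sum>a\<le>s. if a \<le> s - a then e (s - a - a) else 0) + (\<Sum>a\<le>s. R (s, a) (s - a))"
        by (rule sum.distrib)
      also have "(\<Sum>a\<le>s. if a \<le> s - a then e (s - a - a) else 0) = step_sum e s"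
        unfolding step_sum_def
        by (rule sum.mono_neutral_cong_right) (auto simp: mult_2)
      finally show ?thesis .
    qed
    \<comment> \<open>Here \<open>1 + (-1) ^ (n + 1) = 2\<close>, which cancels one factor of the
      denominator and leaves the parity coefficient of \<open>e\<close>.\<close>
    then show ?thesis
      using False polyfun_add[OF e(2)[unfolded parity_part_def] polyfun3_antidiagonal[OF R]]
      by (simp add: algebra_simps)
  qed
qed

section \<open>Growth of the number of labellings\<close>

text \<open>In both bounds there are \<open>c\<close> choices for each cycle label and
  \<open>c ^ (k i - 1)\<close> for the loops at vertex \<open>i\<close>, one loop being determined
  by the others.\<close>

lemma prod_power_sum_pred:
  assumes "\<forall>i\<in>{1..n}. k i \<ge> (1 :: nat)"
  shows "c ^ n * (\<Prod>i=1..n. c ^ (k i - 1)) = (c :: nat) ^ (\<Sum>i=1..n. k i)"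
proof -
  have "c ^ n * (\<Prod>i=1..n. c ^ (k i - 1)) = (\<Prod>i=1..n. c * c ^ (k i - 1))"
    by (simp add: prod.distrib)
  also have "\<dots> = (\<Prod>i=1..n. c ^ k i)"
  proof (intro prod.cong refl)
    fix i assume "i \<in> {1..n}"
    then show "c * c ^ (k i - 1) = c ^ k i"
      using assms[rule_format, of i] power_minus_mult[of "k i" c] by (simp add: mult.commute)
  qed
  finally show ?thesis by (simp add: power_sum)
qed

lemma h_upper:
  assumes "\<forall>i\<in>{1..n}. k i \<ge> 1"
  shows "h n k s \<le> (s + 1) ^ (\<Sum>i=1..n. k i)"
proof -
  have "loops (k i) s a b \<le> (s + 1) ^ (k i - 1)" if i: "i \<in> {1..n}" for i a b
  proof -
    obtain k' where "k i = Suc k'" using assms[rule_format, OF i] by (cases "k i") auto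
    then show ?thesis
      using order_trans[OF comps_upper power_mono[of "s - (a + b) + 1" "s + 1" k']]
      by (simp add: loops_def del: comps.simps)
  qed
  then have "h n k s \<le> (\<Sum>\<beta>\<in>{1..n} \<rightarrow>\<^sub>E {..s}. \<Prod>i=1..n. (s + 1) ^ (k i - 1))"
    unfolding h_eq_sum_loops by (intro sum_mono prod_mono) auto
  also have "\<dots> = (s + 1) ^ n * (\<Prod>i=1..n. (s + 1) ^ (k i - 1))"
    by (simp add: card_PiE)
  finally show ?thesis by (simp only: prod_power_sum_pred[OF assms])
qed

text \<open>With all cycle labels at most \<open>t\<close>, two of them use at most
  \<open>2 * t\<close> at a vertex. The magic sum leaves enough for all loops there but one to range
  freely over \<open>{..t}\<close>; the last loop takes up the rest.\<close>

lemma h_lower: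
  assumes "\<forall>i\<in>{1..n}. k i \<ge> 1"
  shows "(t + 1) ^ (\<Sum>i=1..n. k i) \<le> h n k (((\<Sum>i=1..n. k i) + 2) * t)"
proof -
  define s where "s = ((\<Sum>i=1..n. k i) + 2) * t"
  have low: "(t + 1) ^ (k i - 1) \<le> loops (k i) s a b"
    if i: "i \<in> {1..n}" and ab: "a \<le> t" "b \<le> t" for i a b
  proof -
    obtain k' where k': "k i = Suc k'" using assms[rule_format, OF i] by (cases "k i") auto
    have "k i \<le> (\<Sum>i=1..n. k i)" using i by (intro member_le_sum) auto
    then have "(k' + 2) * t \<le> s" unfolding s_def k' by (intro mult_le_mono1) auto
    then have "a + b \<le> s" "t * k' \<le> s - (a + b)" using ab by (auto simp: algebra_simps)
    then show ?thesis
      using comps_lower[of t k' "s - (a + b)"] by (simp add: loops_def k' del: comps.simps)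
  qed
  have sub: "{1..n} \<rightarrow>\<^sub>E {..t} \<subseteq> {1..n} \<rightarrow>\<^sub>E {..s}"
    by (intro PiE_mono) (auto simp: s_def)
  have "(t + 1) ^ (\<Sum>i=1..n. k i) = (\<Sum>\<beta>\<in>{1..n} \<rightarrow>\<^sub>E {..t}. \<Prod>i=1..n. (t + 1) ^ (k i - 1))"
    unfolding prod_power_sum_pred[OF assms, symmetric] by (simp add: card_PiE)
  also have "\<dots> \<le> (\<Sum>\<beta>\<in>{1..n} \<rightarrow>\<^sub>E {..t}. \<Prod>i=1..n. loops (k i) s (\<beta> i) (\<beta> (next_vertex n i)))"
    by (intro sum_mono prod_mono conjI low) (auto simp: PiE_iff next_vertex_def)
  also have "\<dots> \<le> h n k s"
    unfolding h_eq_sum_loops using sub by (intro sum_mono2 finite_PiE) auto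
  finally show ?thesis by (simp only: s_def)
qed

section \<open>The degree of a polynomial from its growth\<close>

lemma poly_power_bound:
  fixes p :: "'a::linordered_field poly"
  assumes "degree p \<le> m"
  shows "\<exists>C. \<forall>x\<ge>1. \<bar>poly p x\<bar> \<le> C * x ^ m"
proof (intro exI[of _ "\<Sum>i\<le>degree p. \<bar>coeff p i\<bar>"] allI impI)
  fix x :: 'a assume x: "x \<ge> 1"
  have "\<bar>poly p x\<bar> \<le> (\<Sum>i\<le>degree p. \<bar>coeff p i\<bar> * x ^ i)"
    unfolding poly_altdef using x by (intro order_trans[OF sum_abs]) (simp add: abs_mult)
  also have "\<dots> \<le> (\<Sum>i\<le>degree p. \<bar>coeff p i\<bar> * x ^ m)"
    using x assms by (intro sum_mono mult_left_mono power_increasing) auto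
  finally show "\<bar>poly p x\<bar> \<le> (\<Sum>i\<le>degree p. \<bar>coeff p i\<bar>) * x ^ m"
    by (simp add: sum_distrib_right)
qed

lemma not_power_Suc_bounded:
  fixes c C :: "'a::archimedean_field"
  assumes "c > 0" "\<And>t::nat. t \<ge> 1 \<Longrightarrow> c * of_nat t ^ Suc m \<le> C * of_nat t ^ m"
  shows False
proof -
  obtain t :: nat where t: "C / c < of_nat t" by (rule reals_Archimedean2[THEN exE])
  then have "C / c < of_nat (Suc t)" by (rule less_trans) simp
  moreover have "c * of_nat (Suc t) \<le> C"
    using assms(2)[of "Suc t"] by (simp add: mult.assoc[symmetric] del: of_nat_Suc)
  ultimately show False using assms(1) by (simp add: field_simps)
qed

lemma degree_ge_of_lower_bound:
  fixes p :: "'a::archimedean_field poly"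
  assumes "\<And>t::nat. t \<ge> 1 \<Longrightarrow> of_nat t ^ m \<le> poly p (of_nat t)"
  shows "m \<le> degree p"
proof (rule ccontr)
  assume "\<not> m \<le> degree p"
  then obtain d where m: "m = Suc d" and "degree p \<le> d" by (cases m) auto
  then obtain C where C: "\<And>x. x \<ge> 1 \<Longrightarrow> \<bar>poly p x\<bar> \<le> C * x ^ d"
    using poly_power_bound by blast
  show False
  proof (rule not_power_Suc_bounded[of 1])
    fix t :: nat assume t: "t \<ge> 1"
    then have "1 \<le> (of_nat t :: 'a)" by simp
    with assms[OF t] show "1 * of_nat t ^ Suc d \<le> C * of_nat t ^ d"
      unfolding m mult_1 using C abs_ge_self by (meson order_trans)
  qed simp
qed

lemma degree_le_of_upper_bound:
  fixes p :: "'a::archimedean_field poly"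
  assumes "\<And>t::nat. t \<ge> 1 \<Longrightarrow> \<bar>poly p (of_nat t)\<bar> \<le> B * of_nat t ^ m"
  shows "degree p \<le> m"
proof (rule ccontr)
  assume "\<not> degree p \<le> m"
  then obtain d where d: "degree p = Suc d" "m \<le> d" by (cases "degree p") auto
  \<comment> \<open>Without its leading term the polynomial is of order \<open>t ^ d\<close>, so the
    bound on \<open>p\<close> would force the leading term, of order \<open>t ^ Suc d\<close>, to be
    of order \<open>t ^ d\<close> too.\<close>
  define q where "q = p - monom (lead_coeff p) (Suc d)"
  have "degree q \<le> d"
    unfolding q_def by (rule degree_le) (auto simp: coeff_eq_0 d)
  then obtain C where C: "\<And>x. x \<ge> 1 \<Longrightarrow> \<bar>poly q x\<bar> \<le> C * x ^ d"
    using poly_power_bound by blast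
  have "B \<ge> 0" using order_trans[OF abs_ge_zero assms[of 1]] by simp
  show False
  proof (rule not_power_Suc_bounded[of "\<bar>lead_coeff p\<bar>"])
    have "p \<noteq> 0" using d(1) by auto
    then show "\<bar>lead_coeff p\<bar> > 0" by simp
    fix t :: nat assume t: "t \<ge> 1"
    have "lead_coeff p * of_nat t ^ Suc d = poly p (of_nat t) - poly q (of_nat t)"
      by (simp add: q_def poly_monom)
    then have "\<bar>lead_coeff p\<bar> * of_nat t ^ Suc d \<le> \<bar>poly p (of_nat t)\<bar> + \<bar>poly q (of_nat t)\<bar>"
      by (metis abs_mult abs_of_nat abs_triangle_ineq4 power_abs)
    also have "\<dots> \<le> B * of_nat t ^ m + C * of_nat t ^ d"
      using t by (intro add_mono assms C) auto
    also have "\<dots> \<le> B * of_nat t ^ d + C * of_nat t ^ d"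
      using t d(2) \<open>B \<ge> 0\<close> by (intro add_right_mono mult_left_mono power_increasing) auto
    finally show "\<bar>lead_coeff p\<bar> * of_nat t ^ Suc d \<le> (B + C) * of_nat t ^ d"
      by (simp add: distrib_right)
  qed
qed

theorem theorem1p5:
  fixes n :: nat and k :: "nat \<Rightarrow> nat"
  assumes "n \<ge> 1" and "\<forall>i\<in>{1..n}. k i \<ge> 1"
  shows "\<exists>\<phi> :: rat poly. degree \<phi> = (\<Sum>i=1..n. k i) \<and>
           (\<forall>s::nat. s > 0 \<longrightarrow>
              of_nat (h n k s) =
                poly \<phi> (of_nat s) + (-1) ^ s * (1 + (-1) ^ (n + 1)) / 2 ^ ((\<Sum>i=1..n. k i) + 2))"
proof -
  define K where "K = (\<Sum>i=1..n. k i)"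
  define \<epsilon> :: "nat \<Rightarrow> rat" where "\<epsilon> s = (-1) ^ s * (1 + (-1) ^ (n + 1)) / 2 ^ (K + 2)" for s
  obtain \<phi> where \<phi>: "\<And>s. of_nat (h n k s) - \<epsilon> s = poly \<phi> (of_nat s)"
    using polyfun_h[OF assms] unfolding polyfun_def \<epsilon>_def K_def by blast
  \<comment> \<open>A bounded correction does not affect the degree; the explicit bound 1 serves the
    lower estimate.\<close>
  have \<epsilon>: "\<bar>\<epsilon> s\<bar> \<le> 1" for s
  proof -
    have "(2 :: rat) ^ 1 \<le> 2 ^ (K + 2)" by (intro power_increasing) auto
    then show ?thesis by (cases "even n") (simp_all add: \<epsilon>_def abs_mult power_abs)
  qed
  have "k 1 \<le> K" unfolding K_def using assms(1) by (intro member_le_sum) auto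
  then have K: "K \<ge> 1" using assms by (auto dest: bspec[of _ _ 1])
  have "degree \<phi> \<le> K"
  proof (rule degree_le_of_upper_bound)
    fix t :: nat assume t: "t \<ge> 1"
    have "h n k t \<le> (2 * t) ^ K"
      using order_trans[OF h_upper[OF assms(2)] power_mono[of "t + 1" "2 * t"]] t
      by (simp add: K_def)
    then have "of_nat (h n k t) \<le> (of_nat ((2 * t) ^ K) :: rat)" by (simp only: of_nat_le_iff)
    moreover have "(1 :: rat) \<le> of_nat t ^ K" using t by (intro one_le_power) simp
    ultimately show "\<bar>poly \<phi> (of_nat t)\<bar> \<le> (2 ^ K + 1) * of_nat t ^ K"
      using \<epsilon>[of t] unfolding \<phi>[symmetric] by (simp add: power_mult_distrib algebra_simps)
  qed
  \<comment> \<open>The lower bound is known only at multiples of \<open>K + 2\<close>, so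
    \<open>\<phi>\<close> is composed with this scaling, which preserves the degree.\<close>
  moreover have "K \<le> degree (pcompose \<phi> [:0, of_nat (K + 2):])"
  proof (rule degree_ge_of_lower_bound)
    fix t :: nat assume "t \<ge> 1"
    \<comment> \<open>The spare 1, available since \<open>K \<ge> 1\<close>, absorbs the
      correction.\<close>
    have "t ^ K + 1 \<le> (t + 1) ^ K"
      using power_strict_mono[of t "t + 1" K] K by simp
    also have "\<dots> \<le> h n k ((K + 2) * t)" using h_lower[OF assms(2)] by (simp only: K_def)
    finally have "of_nat t ^ K + 1 \<le> (of_nat (h n k ((K + 2) * t)) :: rat)"
      by (metis of_nat_1 of_nat_add of_nat_le_iff of_nat_power)
    moreover have "poly (pcompose \<phi> [:0, of_nat (K + 2):]) (of_nat t)
        = of_nat (h n k ((K + 2) * t)) - \<epsilon> ((K + 2) * t)"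
      by (simp only: \<phi> poly_pcompose) (simp add: algebra_simps)
    ultimately show "of_nat t ^ K \<le> poly (pcompose \<phi> [:0, of_nat (K + 2):]) (of_nat t)"
      using \<epsilon>[of "(K + 2) * t"] by linarith
  qed
  ultimately have "degree \<phi> = K" by (simp add: degree_pcompose del: of_nat_add)
  moreover have "of_nat (h n k s) = poly \<phi> (of_nat s) + \<epsilon> s" for s
    using \<phi>[of s] by (simp add: algebra_simps)
  ultimately show ?thesis by (auto simp: K_def \<epsilon>_def)
qed

end
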